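(* Let $T$ be a complete first-order theory in a countable language with monster model $M$. Suppose that $p\in S_1(\emptyset)$ is asymmetric and that $S^p_{\mapsto}$ is closed in $S_{p,p}$. Then semi-isolation is partially definable on $p(M)$. In particular, $T$ has the strict order property.
   Context: For an $L$-formula $\phi(x,y)$ write $a\to^{\phi}b$ if $\models\phi(a,b)$ and $\phi(a,y)\vdash\mathrm{tp}(b)$; $a\to b$ means $a\to^{\phi}b$ for some $L$-formula $\phi$ (semi-isolation). $a\mapsto b$ means $a\to b$ and not $b\to a$; $a\mapsto^{\phi}b$ means $a\to^{\phi}b$ and not $b\to a$. For $p\in S_1(\emptyset)$, $SI_p=\{(a,b)\in p(M)^2:a\to b\}$; $p$ is asymmetric if it is non-isolated and $SI_p$ is not symmetric. $S_{p,p}$ is the space of complete types in $S_2(\emptyset)$ extending $p(x)\cup p(y)$ (subspace topology), and $S^p_{\mapsto}=\{\mathrm{tp}(ab)\in S_{p,p}: a\mapsto b\}$. A $p$-order is a quasi-order on $p(M)$ with infinite strictly increasing chains which is relatively definable within $p(M)^2$ and is contained in $SI_p$. Semi-isolation is partially definable on $p$ if there is a definable quasi-order $\leq$ (defined by a formula $x\leq y$) such that (i) the restriction of $\leq$ to $p(M)$ is a $p$-order, and (ii) for all $a,b,b'$ with $a\in p(M)$, $b'\in p(M)$: if $a\mapsto^{\leq}b$ and $b\to b'$ then $a\mapsto^{\leq}b'$. *)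

theory Defs
  imports "HOL-Analysis.Analysis"
begin

unbundle cardinal_syntax

section \<open>First-order logic\<close>

record ('f, 'r) language =
  funs :: "'f set"
  rels :: "'r set"
  fun_arity :: "'f \<Rightarrow> nat"
  rel_arity :: "'r \<Rightarrow> nat"

definition countable_language :: "('f, 'r) language \<Rightarrow> bool" where
  "countable_language L \<longleftrightarrow> countable (funs L) \<and> countable (rels L)"

text \<open>Variables are de Bruijn indices: \<open>Ex\<close> binds index \<open>0\<close> of its body. An \<open>n\<close>-tuple of elements is
  a list of length \<open>n\<close>, and index \<open>i\<close> stands for its \<open>i\<close>-th entry.\<close>

datatype 'f trm = Var nat | Fn 'f "'f trm list"

datatype ('f, 'r) fml =
    Eq "'f trm" "'f trm"
  | Rel 'r "'f trm list"
  | Neg "('f, 'r) fml"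
  | And "('f, 'r) fml" "('f, 'r) fml"
  | Ex "('f, 'r) fml"

primrec wf_trm :: "('f, 'r) language \<Rightarrow> nat \<Rightarrow> 'f trm \<Rightarrow> bool" where
  "wf_trm L n (Var i) \<longleftrightarrow> i < n"
| "wf_trm L n (Fn f ts) \<longleftrightarrow>
     f \<in> funs L \<and> length ts = fun_arity L f \<and> list_all (\<lambda>b. b) (map (wf_trm L n) ts)"

primrec wf_fml :: "('f, 'r) language \<Rightarrow> nat \<Rightarrow> ('f, 'r) fml \<Rightarrow> bool" where
  "wf_fml L n (Eq s t) \<longleftrightarrow> wf_trm L n s \<and> wf_trm L n t"
| "wf_fml L n (Rel R ts) \<longleftrightarrow>
     R \<in> rels L \<and> length ts = rel_arity L R \<and> list_all (wf_trm L n) ts"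
| "wf_fml L n (Neg \<phi>) \<longleftrightarrow> wf_fml L n \<phi>"
| "wf_fml L n (And \<phi> \<psi>) \<longleftrightarrow> wf_fml L n \<phi> \<and> wf_fml L n \<psi>"
| "wf_fml L n (Ex \<phi>) \<longleftrightarrow> wf_fml L (Suc n) \<phi>"

text \<open>The \<open>L\<close>-formulas whose free variables are among the first \<open>n\<close>.\<close>

definition formulas :: "('f, 'r) language \<Rightarrow> nat \<Rightarrow> ('f, 'r) fml set" where
  "formulas L n = {\<phi>. wf_fml L n \<phi>}"

primrec rename_trm :: "(nat \<Rightarrow> nat) \<Rightarrow> 'f trm \<Rightarrow> 'f trm" where
  "rename_trm r (Var i) = Var (r i)"
| "rename_trm r (Fn f ts) = Fn f (map (rename_trm r) ts)"

primrec rename :: "(nat \<Rightarrow> nat) \<Rightarrow> ('f, 'r) fml \<Rightarrow> ('f, 'r) fml" where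
  "rename r (Eq s t) = Eq (rename_trm r s) (rename_trm r t)"
| "rename r (Rel R ts) = Rel R (map (rename_trm r) ts)"
| "rename r (Neg \<phi>) = Neg (rename r \<phi>)"
| "rename r (And \<phi> \<psi>) = And (rename r \<phi>) (rename r \<psi>)"
| "rename r (Ex \<phi>) = Ex (rename (case_nat 0 (\<lambda>i. Suc (r i))) \<phi>)"

text \<open>The universe of a structure is the whole type \<open>'m\<close>; the interpretations matter only for
  symbols of the language applied to lists of the right length.\<close>

record ('f, 'r, 'm) struct =
  fun_interp :: "'f \<Rightarrow> 'm list \<Rightarrow> 'm"
  rel_interp :: "'r \<Rightarrow> 'm list \<Rightarrow> bool"

primrec eval :: "('f, 'r, 'm) struct \<Rightarrow> 'm list \<Rightarrow> 'f trm \<Rightarrow> 'm" where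
  "eval M xs (Var i) = xs ! i"
| "eval M xs (Fn f ts) = fun_interp M f (map (eval M xs) ts)"

primrec sat :: "('f, 'r, 'm) struct \<Rightarrow> ('f, 'r) fml \<Rightarrow> 'm list \<Rightarrow> bool" where
  "sat M (Eq s t) xs \<longleftrightarrow> eval M xs s = eval M xs t"
| "sat M (Rel R ts) xs \<longleftrightarrow> rel_interp M R (map (eval M xs) ts)"
| "sat M (Neg \<phi>) xs \<longleftrightarrow> \<not> sat M \<phi> xs"
| "sat M (And \<phi> \<psi>) xs \<longleftrightarrow> sat M \<phi> xs \<and> sat M \<psi> xs"
| "sat M (Ex \<phi>) xs \<longleftrightarrow> (\<exists>d. sat M \<phi> (d # xs))"

section \<open>Complete theories and monster models\<close>

text \<open>A complete theory is taken to be deductively closed, so that it contains exactly one of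
  \<open>\<sigma>\<close>, \<open>\<not>\<sigma>\<close> for each sentence \<open>\<sigma>\<close>; its consistency is witnessed by a model.\<close>

definition complete_theory :: "('f, 'r) language \<Rightarrow> ('f, 'r) fml set \<Rightarrow> bool" where
  "complete_theory L T \<longleftrightarrow>
     T \<subseteq> formulas L 0 \<and> (\<forall>\<sigma>\<in>formulas L 0. Neg \<sigma> \<in> T \<longleftrightarrow> \<sigma> \<notin> T)"

definition models :: "('f, 'r, 'm) struct \<Rightarrow> ('f, 'r) fml set \<Rightarrow> bool" where
  "models M T \<longleftrightarrow> (\<forall>\<sigma>\<in>T. sat M \<sigma> [])"

text \<open>A set of formulas in one free variable with parameters from \<open>A\<close> is a set of pairs
  \<open>(\<phi>, as)\<close>, standing for \<open>\<phi>(x, as)\<close> with \<open>as\<close> a tuple from \<open>A\<close>.\<close>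

definition saturated :: "('f, 'r) language \<Rightarrow> 'k rel \<Rightarrow> ('f, 'r, 'm) struct \<Rightarrow> bool" where
  "saturated L \<kappa> M \<longleftrightarrow>
     (\<forall>A :: 'm set. |A| <o \<kappa> \<longrightarrow>
       (\<forall>\<Gamma> \<subseteq> {(\<phi>, as). set as \<subseteq> A \<and> \<phi> \<in> formulas L (Suc (length as))}.
          (\<forall>\<Delta> \<subseteq> \<Gamma>. finite \<Delta> \<longrightarrow> (\<exists>c. \<forall>(\<phi>, as)\<in>\<Delta>. sat M \<phi> (c # as))) \<longrightarrow>
          (\<exists>c. \<forall>(\<phi>, as)\<in>\<Gamma>. sat M \<phi> (c # as))))"

definition elementary_on ::
  "('f, 'r) language \<Rightarrow> ('f, 'r, 'm) struct \<Rightarrow> 'm set \<Rightarrow> ('m \<Rightarrow> 'm) \<Rightarrow> bool" where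
  "elementary_on L M A h \<longleftrightarrow>
     (\<forall>as. set as \<subseteq> A \<longrightarrow>
       (\<forall>\<phi>\<in>formulas L (length as). sat M \<phi> as \<longleftrightarrow> sat M \<phi> (map h as)))"

definition automorphism ::
  "('f, 'r) language \<Rightarrow> ('f, 'r, 'm) struct \<Rightarrow> ('m \<Rightarrow> 'm) \<Rightarrow> bool" where
  "automorphism L M g \<longleftrightarrow> bij g \<and>
     (\<forall>f\<in>funs L. \<forall>xs. length xs = fun_arity L f \<longrightarrow>
        g (fun_interp M f xs) = fun_interp M f (map g xs)) \<and>
     (\<forall>R\<in>rels L. \<forall>xs. length xs = rel_arity L R \<longrightarrow>
        (rel_interp M R xs \<longleftrightarrow> rel_interp M R (map g xs)))"

definition strongly_homogeneous ::
  "('f, 'r) language \<Rightarrow> 'k rel \<Rightarrow> ('f, 'r, 'm) struct \<Rightarrow> bool" where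
  "strongly_homogeneous L \<kappa> M \<longleftrightarrow>
     (\<forall>(A :: 'm set) h. |A| <o \<kappa> \<and> elementary_on L M A h \<longrightarrow>
        (\<exists>g. automorphism L M g \<and> (\<forall>a\<in>A. g a = h a)))"

text \<open>The cardinal \<open>\<kappa>\<close> measures smallness; \<open>\<Union>n. formulas L n\<close> has cardinality \<open>|L| + \<aleph>\<^sub>0\<close>.\<close>

definition monster_model ::
  "('f, 'r) language \<Rightarrow> ('f, 'r) fml set \<Rightarrow> 'k rel \<Rightarrow> ('f, 'r, 'm) struct \<Rightarrow> bool" where
  "monster_model L T \<kappa> M \<longleftrightarrow> models M T \<and> Card_order \<kappa> \<and> |\<Union>n. formulas L n| <o \<kappa> \<and>
     saturated L \<kappa> M \<and> strongly_homogeneous L \<kappa> M"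

text \<open>The strict order property of a complete theory, read in its monster model \<open>M\<close>.\<close>

definition strict_order_property :: "('f, 'r) language \<Rightarrow> ('f, 'r, 'm) struct \<Rightarrow> bool" where
  "strict_order_property L M \<longleftrightarrow>
     (\<exists>m n. \<exists>\<phi>\<in>formulas L (m + n). \<exists>b :: nat \<Rightarrow> 'm list. (\<forall>i. length (b i) = n) \<and>
        (\<forall>i. {xs. length xs = m \<and> sat M \<phi> (xs @ b i)}
               \<subset> {xs. length xs = m \<and> sat M \<phi> (xs @ b (Suc i))}))"

section \<open>Types over the empty set\<close>

definition tp :: "('f, 'r) language \<Rightarrow> ('f, 'r, 'm) struct \<Rightarrow> 'm list \<Rightarrow> ('f, 'r) fml set" where
  "tp L M xs = {\<phi> \<in> formulas L (length xs). sat M \<phi> xs}"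

text \<open>The set \<open>S\<^sub>n(\<emptyset>)\<close> of complete types. Since the theory of \<open>M\<close> is complete, consistency with it
  amounts to finite satisfiability in \<open>M\<close>.\<close>

definition type_space ::
  "('f, 'r) language \<Rightarrow> ('f, 'r, 'm) struct \<Rightarrow> nat \<Rightarrow> ('f, 'r) fml set set" where
  "type_space L M n = {q. q \<subseteq> formulas L n \<and>
     (\<forall>\<phi>\<in>formulas L n. \<phi> \<in> q \<or> Neg \<phi> \<in> q) \<and>
     (\<forall>\<Delta>\<subseteq>q. finite \<Delta> \<longrightarrow> (\<exists>xs. length xs = n \<and> (\<forall>\<phi>\<in>\<Delta>. sat M \<phi> xs)))}"

definition type_topology ::
  "('f, 'r) language \<Rightarrow> ('f, 'r, 'm) struct \<Rightarrow> nat \<Rightarrow> ('f, 'r) fml set topology" where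
  "type_topology L M n =
     topology_generated_by {{q \<in> type_space L M n. \<phi> \<in> q} | \<phi>. \<phi> \<in> formulas L n}"

definition realizations :: "('f, 'r, 'm) struct \<Rightarrow> ('f, 'r) fml set \<Rightarrow> 'm set" where
  "realizations M p = {a. \<forall>\<phi>\<in>p. sat M \<phi> [a]}"

definition isolated_type :: "('f, 'r, 'm) struct \<Rightarrow> ('f, 'r) fml set \<Rightarrow> bool" where
  "isolated_type M p \<longleftrightarrow> (\<exists>\<phi>\<in>p. \<forall>\<psi>\<in>p. \<forall>a. sat M \<phi> [a] \<longrightarrow> sat M \<psi> [a])"

section \<open>Semi-isolation\<close>

definition semi_isolates_by ::
  "('f, 'r) language \<Rightarrow> ('f, 'r, 'm) struct \<Rightarrow> ('f, 'r) fml \<Rightarrow> 'm \<Rightarrow> 'm \<Rightarrow> bool" where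
  "semi_isolates_by L M \<phi> a b \<longleftrightarrow> \<phi> \<in> formulas L 2 \<and> sat M \<phi> [a, b] \<and>
     (\<forall>\<psi>\<in>tp L M [b]. \<forall>c. sat M \<phi> [a, c] \<longrightarrow> sat M \<psi> [c])"

definition semi_isolates ::
  "('f, 'r) language \<Rightarrow> ('f, 'r, 'm) struct \<Rightarrow> 'm \<Rightarrow> 'm \<Rightarrow> bool" where
  "semi_isolates L M a b \<longleftrightarrow> (\<exists>\<phi>\<in>formulas L 2. semi_isolates_by L M \<phi> a b)"

definition strictly_semi_isolates ::
  "('f, 'r) language \<Rightarrow> ('f, 'r, 'm) struct \<Rightarrow> 'm \<Rightarrow> 'm \<Rightarrow> bool" where
  "strictly_semi_isolates L M a b \<longleftrightarrow> semi_isolates L M a b \<and> \<not> semi_isolates L M b a"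

definition strictly_semi_isolates_by ::
  "('f, 'r) language \<Rightarrow> ('f, 'r, 'm) struct \<Rightarrow> ('f, 'r) fml \<Rightarrow> 'm \<Rightarrow> 'm \<Rightarrow> bool" where
  "strictly_semi_isolates_by L M \<phi> a b \<longleftrightarrow>
     semi_isolates_by L M \<phi> a b \<and> \<not> semi_isolates L M b a"

definition SI :: "('f, 'r) language \<Rightarrow> ('f, 'r, 'm) struct \<Rightarrow> ('f, 'r) fml set \<Rightarrow> 'm rel" where
  "SI L M p =
     {(a, b). a \<in> realizations M p \<and> b \<in> realizations M p \<and> semi_isolates L M a b}"

definition asymmetric ::
  "('f, 'r) language \<Rightarrow> ('f, 'r, 'm) struct \<Rightarrow> ('f, 'r) fml set \<Rightarrow> bool" where
  "asymmetric L M p \<longleftrightarrow> \<not> isolated_type M p \<and> \<not> sym (SI L M p)"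

text \<open>With \<open>x\<close>, \<open>y\<close> the variables \<open>0\<close>, \<open>1\<close>, the set \<open>p\<close> itself is \<open>p(x)\<close> and \<open>rename Suc ` p\<close> is \<open>p(y)\<close>.\<close>

definition S_pp ::
  "('f, 'r) language \<Rightarrow> ('f, 'r, 'm) struct \<Rightarrow> ('f, 'r) fml set \<Rightarrow> ('f, 'r) fml set set" where
  "S_pp L M p = {q \<in> type_space L M 2. p \<union> rename Suc ` p \<subseteq> q}"

definition S_mapsto ::
  "('f, 'r) language \<Rightarrow> ('f, 'r, 'm) struct \<Rightarrow> ('f, 'r) fml set \<Rightarrow> ('f, 'r) fml set set" where
  "S_mapsto L M p =
     {tp L M [a, b] | a b. tp L M [a, b] \<in> S_pp L M p \<and> strictly_semi_isolates L M a b}"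

definition p_order ::
  "('f, 'r) language \<Rightarrow> ('f, 'r, 'm) struct \<Rightarrow> ('f, 'r) fml set \<Rightarrow> 'm rel \<Rightarrow> bool" where
  "p_order L M p Q \<longleftrightarrow>
     preorder_on (realizations M p) Q \<and>
     (\<exists>a :: nat \<Rightarrow> 'm. \<forall>i. (a i, a (Suc i)) \<in> Q \<and> (a (Suc i), a i) \<notin> Q) \<and>
     (\<exists>\<phi>\<in>formulas L 2.
        Q = {(a, b). sat M \<phi> [a, b]} \<inter> realizations M p \<times> realizations M p) \<and>
     Q \<subseteq> SI L M p"

definition semi_isolation_partially_definable ::
  "('f, 'r) language \<Rightarrow> ('f, 'r, 'm) struct \<Rightarrow> ('f, 'r) fml set \<Rightarrow> bool" where
  "semi_isolation_partially_definable L M p \<longleftrightarrow>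
     (\<exists>\<phi>\<in>formulas L 2.
        preorder_on UNIV {(a, b). sat M \<phi> [a, b]} \<and>
        p_order L M p ({(a, b). sat M \<phi> [a, b]} \<inter> realizations M p \<times> realizations M p) \<and>
        (\<forall>a\<in>realizations M p. \<forall>b. \<forall>b'\<in>realizations M p.
           strictly_semi_isolates_by L M \<phi> a b \<and> semi_isolates L M b b' \<longrightarrow>
           strictly_semi_isolates_by L M \<phi> a b'))"

end

theory Submission
  imports Defs
begin

text \<open>
  On \<open>p(M)\<close>, semi-isolation is the union of the relations defined by those \<open>\<phi>(x,y)\<close> with
  \<open>\<phi>(a,M) \<subseteq> p(M)\<close> for \<open>a \<Turnstile> p\<close>, and these formulas are closed under disjunction. So if
  \<open>S\<^sup>p\<^sub>\<mapsto>\<close> is closed, compactness yields a single such \<open>\<phi>\<close>, which may be taken reflexive, with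
  \<open>a \<mapsto> b \<Longrightarrow> \<phi>(a,b)\<close>. Let \<open>a \<le> b\<close> mean \<open>\<phi>(b,M) \<subseteq> \<phi>(a,M)\<close>. This is a definable quasi-order;
  by reflexivity of \<open>\<phi>\<close>, \<open>a \<le> b\<close> implies \<open>\<phi>(a,b)\<close> and hence \<open>a \<rightarrow> b\<close>. Conversely \<open>a \<mapsto> b\<close> implies
  \<open>a \<le> b\<close>, because \<open>a \<mapsto> b \<rightarrow> c\<close> gives \<open>a \<mapsto> c\<close>. By homogeneity, a pair \<open>a \<mapsto> b\<close> in \<open>p(M)\<close>
  continues to an infinite strictly increasing chain.
\<close>

section \<open>Renaming of variables and locality of satisfaction\<close>

lemma wf_trm_rename:
  "wf_trm L n t \<Longrightarrow> (\<And>i. i < n \<Longrightarrow> r i < m) \<Longrightarrow> wf_trm L m (rename_trm r t)"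
  by (induction t) (auto simp: list_all_iff)

lemma wf_fml_rename:
  "wf_fml L n \<phi> \<Longrightarrow> (\<And>i. i < n \<Longrightarrow> r i < m) \<Longrightarrow> wf_fml L m (rename r \<phi>)"
proof (induction \<phi> arbitrary: n m r)
  case (Ex \<phi>)
  show ?case
    unfolding rename.simps wf_fml.simps
  proof (rule Ex.IH)
    show "wf_fml L (Suc n) \<phi>"
      using Ex.prems by simp
    \<comment> \<open>Under the binder the renaming fixes the bound index 0 and acts as
      \<open>r\<close> on the shifted free indices.\<close>
    show "case_nat 0 (\<lambda>i. Suc (r i)) i < Suc m" if "i < Suc n" for i
      using that Ex.prems by (auto split: nat.split)
  qed
qed (auto simp: list_all_iff intro: wf_trm_rename)

lemma eval_rename:
  "wf_trm L n t \<Longrightarrow> (\<And>i. i < n \<Longrightarrow> ys ! i = xs ! r i) \<Longrightarrow>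
    eval M xs (rename_trm r t) = eval M ys t"
  by (induction t) (auto simp: list_all_iff comp_def cong: map_cong)

text \<open>Since \<open>r\<close> need not be injective, this covers swapping, identifying and
  shifting variables at once; all composite formulas below are evaluated through it.\<close>

lemma sat_rename:
  "wf_fml L n \<phi> \<Longrightarrow> (\<And>i. i < n \<Longrightarrow> ys ! i = xs ! r i) \<Longrightarrow>
    sat M (rename r \<phi>) xs \<longleftrightarrow> sat M \<phi> ys"
proof (induction \<phi> arbitrary: n xs ys r)
  case (Eq s t)
  then show ?case
    by (simp add: eval_rename[of L n _ ys xs])
next
  case (Rel R ts)
  then have "map (eval M xs) (map (rename_trm r) ts) = map (eval M ys) ts"
    by (auto simp: list_all_iff intro: eval_rename)
  then show ?case
    by (simp only: rename.simps sat.simps)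
next
  case (Neg \<phi>)
  show ?case
    using Neg.IH[of n ys xs r, OF _ Neg.prems(2)] Neg.prems(1) by simp
next
  case (And \<phi> \<psi>)
  show ?case
    using And.IH(1)[of n ys xs r, OF _ And.prems(2)] And.IH(2)[of n ys xs r, OF _ And.prems(2)]
      And.prems(1) by simp
next
  case (Ex \<phi>)
  have "sat M (rename (case_nat 0 (\<lambda>i. Suc (r i))) \<phi>) (d # xs) \<longleftrightarrow> sat M \<phi> (d # ys)" for d
  proof (rule Ex.IH)
    show "wf_fml L (Suc n) \<phi>"
      using Ex.prems by simp
    show "(d # ys) ! i = (d # xs) ! (case i of 0 \<Rightarrow> 0 | Suc i \<Rightarrow> Suc (r i))" if "i < Suc n" for i
      using that Ex.prems by (auto split: nat.split)
  qed
  then show ?case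
    by simp
qed

lemma wf_trm_mono: "wf_trm L n t \<Longrightarrow> n \<le> m \<Longrightarrow> wf_trm L m t"
  by (induction t) (auto simp: list_all_iff)

lemma wf_fml_mono: "wf_fml L n \<phi> \<Longrightarrow> n \<le> m \<Longrightarrow> wf_fml L m \<phi>"
  by (induction \<phi> arbitrary: n m) (auto simp: list_all_iff intro: wf_trm_mono)

lemma eval_cong:
  "wf_trm L n t \<Longrightarrow> (\<And>i. i < n \<Longrightarrow> xs ! i = ys ! i) \<Longrightarrow> eval M xs t = eval M ys t"
  by (induction t) (auto simp: list_all_iff cong: map_cong)

text \<open>Used to read a formula of \<open>p\<close>, which has one free variable, at a
  pair.\<close>

lemma sat_cong:
  "wf_fml L n \<phi> \<Longrightarrow> (\<And>i. i < n \<Longrightarrow> xs ! i = ys ! i) \<Longrightarrow> sat M \<phi> xs \<longleftrightarrow> sat M \<phi> ys"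
proof (induction \<phi> arbitrary: n xs ys)
  case (Eq s t)
  then show ?case
    by (simp add: eval_cong[of L n _ xs ys])
next
  case (Rel R ts)
  then have "map (eval M xs) ts = map (eval M ys) ts"
    by (auto simp: list_all_iff intro: eval_cong)
  then show ?case
    by (simp only: sat.simps)
next
  case (Neg \<phi>)
  show ?case
    using Neg.IH[of n xs ys, OF _ Neg.prems(2)] Neg.prems(1) by simp
next
  case (And \<phi> \<psi>)
  show ?case
    using And.IH(1)[of n xs ys, OF _ And.prems(2)] And.IH(2)[of n xs ys, OF _ And.prems(2)]
      And.prems(1) by simp
next
  case (Ex \<phi>)
  have "sat M \<phi> (d # xs) \<longleftrightarrow> sat M \<phi> (d # ys)" for d
  proof (rule Ex.IH)
    show "wf_fml L (Suc n) \<phi>"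
      using Ex.prems by simp
    show "(d # xs) ! i = (d # ys) ! i" if "i < Suc n" for i
      using that Ex.prems by (cases i) auto
  qed
  then show ?case
    by simp
qed

lemma rename_formulas:
  "\<phi> \<in> formulas L n \<Longrightarrow> (\<And>i. i < n \<Longrightarrow> r i < m) \<Longrightarrow> rename r \<phi> \<in> formulas L m"
  by (auto simp: formulas_def intro: wf_fml_rename)

lemma sat_rename2:
  "\<phi> \<in> formulas L 2 \<Longrightarrow> sat M (rename r \<phi>) xs \<longleftrightarrow> sat M \<phi> [xs ! r 0, xs ! r 1]"
  by (rule sat_rename[of L 2]) (auto simp: formulas_def less_2_cases_iff)

section \<open>Automorphisms and smallness of finite parameter sets\<close>

lemma automorphism_eval:
  assumes "automorphism L M g"
  shows "wf_trm L (length xs) t \<Longrightarrow> eval M (map g xs) t = g (eval M xs t)"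
proof (induction t)
  case (Fn f ts)
  then have "map (eval M (map g xs)) ts = map g (map (eval M xs) ts)"
    by (auto simp: list_all_iff)
  then show ?case
    using Fn.prems assms by (simp only: eval.simps) (simp add: automorphism_def)
qed simp

lemma automorphism_sat:
  assumes "automorphism L M g"
  shows "wf_fml L (length xs) \<phi> \<Longrightarrow> sat M \<phi> (map g xs) \<longleftrightarrow> sat M \<phi> xs"
proof (induction \<phi> arbitrary: xs)
  case (Eq s t)
  then show ?case
    using assms by (simp add: automorphism_eval[OF assms] automorphism_def bij_def inj_eq)
next
  case (Rel R ts)
  then have "map (eval M (map g xs)) ts = map g (map (eval M xs) ts)"
    by (auto simp: list_all_iff automorphism_eval[OF assms])
  moreover have "rel_interp M R (map (eval M xs) ts) \<longleftrightarrow> rel_interp M R (map g (map (eval M xs) ts))"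
    using Rel.prems assms unfolding automorphism_def wf_fml.simps by (metis length_map)
  ultimately show ?case
    by (simp only: sat.simps)
next
  case (Ex \<phi>)
  have "sat M \<phi> (g d # map g xs) \<longleftrightarrow> sat M \<phi> (d # xs)" for d
    using Ex.IH[of "d # xs"] Ex.prems by simp
  \<comment> \<open>Surjectivity writes every witness over the image tuple as some
    \<open>g d\<close>.\<close>
  moreover have "surj g"
    using assms by (simp add: automorphism_def bij_def)
  ultimately show ?case
    by simp (metis surjD)
qed auto

text \<open>The formulas \<open>Eq (Var i) (Var i)\<close> are pairwise distinct, so there are
  infinitely many formulas, and \<open>\<kappa>\<close> exceeds their number. Hence saturation and
  homogeneity apply over finite sets.\<close>

lemma finite_card_less_monster:
  assumes "monster_model L T \<kappa> M" and "finite A"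
  shows "|A| <o \<kappa>"
proof -
  let ?F = "\<Union>n. formulas L n"
  have "range (\<lambda>i. Eq (Var i) (Var i)) \<subseteq> ?F"
  proof clarify
    show "Eq (Var i) (Var i) \<in> ?F" for i
      by (auto simp: formulas_def)
  qed
  moreover have "infinite (range (\<lambda>i. Eq (Var i) (Var i) :: ('a, 'b) fml))"
    by (rule range_inj_infinite) (auto simp: inj_def)
  ultimately have "infinite ?F"
    using finite_subset by blast
  then have "|A| <o |?F|"
    using assms(2) by (meson card_of_Well_order card_of_ordLeq_finite not_ordLeq_iff_ordLess)
  then show ?thesis
    using assms(1) ordLess_transitive unfolding monster_model_def by blast
qed

section \<open>Complete types and their topology\<close>

lemma tp_realization:
  assumes "p \<in> type_space L M 1" and "a \<in> realizations M p"
  shows "tp L M [a] = p"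
proof
  show "p \<subseteq> tp L M [a]"
    using assms by (auto simp: tp_def type_space_def realizations_def)
  show "tp L M [a] \<subseteq> p"
  proof
    fix \<psi> assume "\<psi> \<in> tp L M [a]"
    then have "\<psi> \<in> formulas L 1" "sat M \<psi> [a]"
      by (auto simp: tp_def)
    moreover have "Neg \<psi> \<notin> p"
      using \<open>sat M \<psi> [a]\<close> assms(2) by (auto simp: realizations_def)
    ultimately show "\<psi> \<in> p"
      using assms(1) by (auto simp: type_space_def)
  qed
qed

lemma tp_in_type_space: "tp L M xs \<in> type_space L M (length xs)"
  by (auto simp: type_space_def tp_def formulas_def)

text \<open>Types are given as complete, finitely satisfiable sets rather than deductively closed
  ones. Each failing case would put an unsatisfiable set of two or three formulas into
  \<open>q\<close>.\<close>

lemma And_mem_type_iff: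
  assumes "q \<in> type_space L M n" "\<phi> \<in> formulas L n" "\<psi> \<in> formulas L n"
  shows "And \<phi> \<psi> \<in> q \<longleftrightarrow> \<phi> \<in> q \<and> \<psi> \<in> q"
proof -
  have sat: "\<exists>xs. length xs = n \<and> (\<forall>\<xi>\<in>\<Delta>. sat M \<xi> xs)" if "finite \<Delta>" "\<Delta> \<subseteq> q" for \<Delta>
    using assms(1) that unfolding type_space_def by blast
  have compl: "\<xi> \<in> q \<or> Neg \<xi> \<in> q" if "\<xi> \<in> formulas L n" for \<xi>
    using assms(1) that unfolding type_space_def by blast
  have "And \<phi> \<psi> \<in> formulas L n"
    using assms by (simp add: formulas_def)
  then show ?thesis
    using compl[of "And \<phi> \<psi>"] compl[of \<phi>] compl[of \<psi>] assms(2,3)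
      sat[of "{And \<phi> \<psi>, Neg \<phi>}"] sat[of "{And \<phi> \<psi>, Neg \<psi>}"] sat[of "{Neg (And \<phi> \<psi>), \<phi>, \<psi>}"]
    by auto
qed

text \<open>Conjunction makes the intersection of two generating sets a generating set again, so
  these sets form a base.\<close>

lemma type_topology_nbhd:
  assumes "openin (type_topology L M n) U" "q \<in> U" "q \<in> type_space L M n" "n > 0"
  shows "\<exists>\<xi>\<in>formulas L n. \<xi> \<in> q \<and> {q' \<in> type_space L M n. \<xi> \<in> q'} \<subseteq> U"
proof -
  have "generate_topology_on {{q \<in> type_space L M n. \<phi> \<in> q} | \<phi>. \<phi> \<in> formulas L n} U"
    using assms(1) by (simp add: type_topology_def openin_topology_generated_by_iff)
  then show ?thesis
    using assms(2)
  proof (induction rule: generate_topology_on.induct)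
    case (Int U V)
    then obtain \<phi> \<psi> where \<phi>: "\<phi> \<in> formulas L n" "\<phi> \<in> q" "{q' \<in> type_space L M n. \<phi> \<in> q'} \<subseteq> U"
      and \<psi>: "\<psi> \<in> formulas L n" "\<psi> \<in> q" "{q' \<in> type_space L M n. \<psi> \<in> q'} \<subseteq> V"
      by blast
    have "And \<phi> \<psi> \<in> formulas L n"
      using \<phi>(1) \<psi>(1) by (simp add: formulas_def)
    moreover have "And \<phi> \<psi> \<in> q"
      using And_mem_type_iff[OF assms(3) \<phi>(1) \<psi>(1)] \<phi>(2) \<psi>(2) by simp
    moreover have "{q' \<in> type_space L M n. And \<phi> \<psi> \<in> q'} \<subseteq> U \<inter> V"
      using And_mem_type_iff[OF _ \<phi>(1) \<psi>(1)] \<phi>(3) \<psi>(3) by blast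
    ultimately show ?case
      by blast
  next
    case (UN K)
    then obtain k where "k \<in> K" "q \<in> k"
      by blast
    with UN.IH show ?case
      by blast
  qed auto
qed

text \<open>The generating set of \<open>Eq (Var 0) (Var 0)\<close> is already the whole type space,
  because the negation of this formula is unsatisfiable.\<close>

lemma topspace_type_topology:
  assumes "n > 0"
  shows "topspace (type_topology L M n) = type_space L M n"
proof -
  have top: "Eq (Var 0) (Var 0) \<in> formulas L n"
    using assms by (simp add: formulas_def)
  have "Eq (Var 0) (Var 0) \<in> q" if q: "q \<in> type_space L M n" for q
  proof (rule ccontr)
    assume "Eq (Var 0) (Var 0) \<notin> q"
    then have "{Neg (Eq (Var 0) (Var 0))} \<subseteq> q"
      using q top by (auto simp: type_space_def)
    then have "\<exists>xs. \<forall>\<phi>\<in>{Neg (Eq (Var 0) (Var 0))}. sat M \<phi> xs"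
      using q unfolding type_space_def by blast
    then show False
      by simp
  qed
  then show ?thesis
    using top unfolding type_topology_def topology_generated_by_topspace by blast
qed

section \<open>Semi-isolation on \<open>p(M)\<close> through confining formulas\<close>

text \<open>For \<open>a \<Turnstile> p\<close> these are the \<open>\<phi>(x,y)\<close> with \<open>\<phi>(a,y) \<turnstile> p(y)\<close>.\<close>

definition confining ::
  "('f, 'r) language \<Rightarrow> ('f, 'r, 'm) struct \<Rightarrow> ('f, 'r) fml set \<Rightarrow> ('f, 'r) fml set" where
  "confining L M p =
     {\<phi> \<in> formulas L 2. \<forall>a\<in>realizations M p. \<forall>c. sat M \<phi> [a, c] \<longrightarrow> c \<in> realizations M p}"

lemma confining_Eq: "Eq (Var 0) (Var 1) \<in> confining L M p"
  by (auto simp: confining_def formulas_def)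

text \<open>The formula encodes a disjunction. This closure makes the confining formulas directed,
  as compactness requires.\<close>

lemma confining_Or:
  "\<phi> \<in> confining L M p \<Longrightarrow> \<psi> \<in> confining L M p \<Longrightarrow>
    Neg (And (Neg \<phi>) (Neg \<psi>)) \<in> confining L M p"
  unfolding confining_def formulas_def mem_Collect_eq sat.simps wf_fml.simps by blast

locale monster_type =
  fixes L :: "('f, 'r) language"
    and T :: "('f, 'r) fml set"
    and \<kappa> :: "'k rel"
    and M :: "('f, 'r, 'm) struct"
    and p :: "('f, 'r) fml set"
  assumes monster: "monster_model L T \<kappa> M"
    and type: "p \<in> type_space L M 1"
begin

lemma formulas_1: "\<psi> \<in> p \<Longrightarrow> \<psi> \<in> formulas L 1"
  using type unfolding type_space_def by blast

text \<open>A tuple over \<open>{a}\<close> only repeats \<open>a\<close>, so identifying all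
  variables reduces elementarity of the map to equality of the 1-types of \<open>a\<close> and
  \<open>b\<close>.\<close>

lemma homogeneous:
  assumes "a \<in> realizations M p" "b \<in> realizations M p"
  obtains g where "automorphism L M g" "g a = b"
proof -
  have "elementary_on L M {a} (\<lambda>_. b)"
    unfolding elementary_on_def
  proof (intro allI impI ballI)
    fix as \<phi> assume as: "set as \<subseteq> {a}" and \<phi>: "\<phi> \<in> formulas L (length as)"
    have "sat M (rename (\<lambda>_. 0) \<phi>) [a] \<longleftrightarrow> sat M \<phi> as"
      using \<phi> as by (intro sat_rename[of L "length as"]) (auto simp: formulas_def dest: nth_mem)
    moreover have "sat M (rename (\<lambda>_. 0) \<phi>) [b] \<longleftrightarrow> sat M \<phi> (map (\<lambda>_. b) as)"
      using \<phi> by (intro sat_rename[of L "length as"]) (auto simp: formulas_def)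
    moreover have "tp L M [a] = tp L M [b]"
      using assms tp_realization[OF type] by simp
    then have "sat M (rename (\<lambda>_. 0) \<phi>) [a] \<longleftrightarrow> sat M (rename (\<lambda>_. 0) \<phi>) [b]"
      using rename_formulas[OF \<phi>, of "\<lambda>_. 0" 1] by (auto simp: tp_def)
    ultimately show "sat M \<phi> as \<longleftrightarrow> sat M \<phi> (map (\<lambda>_. b) as)"
      by simp
  qed
  moreover have "|{a}| <o \<kappa>"
    by (rule finite_card_less_monster[OF monster]) simp
  ultimately obtain g where "automorphism L M g" "\<forall>x\<in>{a}. g x = b"
    using monster unfolding monster_model_def strongly_homogeneous_def by blast
  then show thesis
    using that by blast
qed

lemma automorphism_realizations:
  assumes "automorphism L M g"
  shows "g a \<in> realizations M p \<longleftrightarrow> a \<in> realizations M p"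
proof -
  have "sat M \<psi> [g a] \<longleftrightarrow> sat M \<psi> [a]" if "\<psi> \<in> p" for \<psi>
    using automorphism_sat[OF assms, of "[a]" \<psi>] formulas_1[OF that] by (simp add: formulas_def)
  then show ?thesis
    by (simp add: realizations_def)
qed

lemma automorphism_sat2:
  assumes "automorphism L M g" "\<phi> \<in> formulas L 2"
  shows "sat M \<phi> [g a, g b] \<longleftrightarrow> sat M \<phi> [a, b]"
  using automorphism_sat[OF assms(1), of "[a, b]" \<phi>] assms(2)
  by (simp add: formulas_def numeral_2_eq_2)

text \<open>An automorphism taking \<open>a\<close> to another realization \<open>a'\<close> carries
  \<open>\<phi>(a,M)\<close> onto \<open>\<phi>(a',M)\<close> and preserves \<open>p(M)\<close>.
  Hence whether \<open>\<phi>(a,M)\<close> stays inside \<open>p(M)\<close> does not depend on the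
  choice of \<open>a\<close>.\<close>

lemma semi_isolates_by_confining:
  assumes "a \<in> realizations M p" "b \<in> realizations M p"
  shows "semi_isolates_by L M \<phi> a b \<longleftrightarrow> \<phi> \<in> confining L M p \<and> sat M \<phi> [a, b]"
proof
  assume si: "semi_isolates_by L M \<phi> a b"
  then have \<phi>: "\<phi> \<in> formulas L 2" "sat M \<phi> [a, b]"
    and conf: "\<And>c. sat M \<phi> [a, c] \<Longrightarrow> c \<in> realizations M p"
    using tp_realization[OF type assms(2)] by (auto simp: semi_isolates_by_def realizations_def)
  have "c \<in> realizations M p" if a': "a' \<in> realizations M p" and sat: "sat M \<phi> [a', c]" for a' c
  proof -
    obtain g where g: "automorphism L M g" "g a = a'"
      using homogeneous[OF assms(1) a'] .
    then obtain c' where "c = g c'"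
      unfolding automorphism_def by (meson bij_pointE)
    then show ?thesis
      using sat g conf automorphism_sat2[OF g(1) \<phi>(1)] automorphism_realizations[OF g(1)] by auto
  qed
  with \<phi> show "\<phi> \<in> confining L M p \<and> sat M \<phi> [a, b]"
    by (auto simp: confining_def)
next
  assume "\<phi> \<in> confining L M p \<and> sat M \<phi> [a, b]"
  then show "semi_isolates_by L M \<phi> a b"
    using assms(1) tp_realization[OF type assms(2)]
    unfolding semi_isolates_by_def confining_def realizations_def by blast
qed

lemma semi_isolates_iff:
  assumes "a \<in> realizations M p" "b \<in> realizations M p"
  shows "semi_isolates L M a b \<longleftrightarrow> (\<exists>\<phi>\<in>confining L M p. sat M \<phi> [a, b])"
  using semi_isolates_by_confining[OF assms]
  by (auto simp: semi_isolates_def confining_def)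

lemma semi_isolates_trans:
  assumes R: "a \<in> realizations M p" "b \<in> realizations M p" "c \<in> realizations M p"
    and "semi_isolates L M a b" "semi_isolates L M b c"
  shows "semi_isolates L M a c"
proof -
  obtain \<phi> \<psi> where \<phi>: "\<phi> \<in> confining L M p" "sat M \<phi> [a, b]"
    and \<psi>: "\<psi> \<in> confining L M p" "sat M \<psi> [b, c]"
    using assms by (auto simp: semi_isolates_iff)
  then have f: "\<phi> \<in> formulas L 2" "\<psi> \<in> formulas L 2"
    by (auto simp: confining_def)
  \<comment> \<open>The composition of \<open>\<phi>\<close> and \<open>\<psi>\<close>: index 0 is
    the bound midpoint, indices 1 and 2 are the outer variables. It is confining because
    \<open>\<phi>\<close> already forces the midpoint into \<open>p(M)\<close>.\<close>
  define \<theta> where "\<theta> = Ex (And (rename (case_nat 1 (\<lambda>_. 0)) \<phi>) (rename (case_nat 0 (\<lambda>_. 2)) \<psi>))"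
  have sat_\<theta>: "sat M \<theta> [x, z] \<longleftrightarrow> (\<exists>y. sat M \<phi> [x, y] \<and> sat M \<psi> [y, z])" for x z
    by (simp add: \<theta>_def sat_rename2[OF f(1)] sat_rename2[OF f(2)])
  have "rename (case_nat 1 (\<lambda>_. 0)) \<phi> \<in> formulas L 3" "rename (case_nat 0 (\<lambda>_. 2)) \<psi> \<in> formulas L 3"
    using f by (auto intro!: rename_formulas split: nat.split)
  then have "\<theta> \<in> formulas L 2"
    by (simp add: \<theta>_def formulas_def numeral_3_eq_3 numeral_2_eq_2)
  then have "\<theta> \<in> confining L M p"
    using \<phi>(1) \<psi>(1) unfolding confining_def sat_\<theta> mem_Collect_eq by blast
  moreover have "sat M \<theta> [a, c]"
    using sat_\<theta> \<phi>(2) \<psi>(2) by blast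
  ultimately show ?thesis
    using R by (auto simp: semi_isolates_iff)
qed

text \<open>If also \<open>c \<rightarrow> a\<close>, then
  \<open>b \<rightarrow> c \<rightarrow> a\<close> would give
  \<open>b \<rightarrow> a\<close>.\<close>

lemma strictly_semi_isolates_trans:
  assumes "a \<in> realizations M p" "b \<in> realizations M p" "c \<in> realizations M p"
    and "strictly_semi_isolates L M a b" "semi_isolates L M b c"
  shows "strictly_semi_isolates L M a c"
  using assms semi_isolates_trans unfolding strictly_semi_isolates_def by blast

lemma automorphism_strictly_semi_isolates:
  assumes g: "automorphism L M g" and R: "a \<in> realizations M p" "b \<in> realizations M p"
  shows "strictly_semi_isolates L M (g a) (g b) \<longleftrightarrow> strictly_semi_isolates L M a b"
proof -
  have "semi_isolates L M (g x) (g y) \<longleftrightarrow> semi_isolates L M x y"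
    if "x \<in> realizations M p" "y \<in> realizations M p" for x y
  proof -
    have "sat M \<phi> [g x, g y] \<longleftrightarrow> sat M \<phi> [x, y]" if "\<phi> \<in> confining L M p" for \<phi>
      using that automorphism_sat2[OF g] by (simp add: confining_def)
    then show ?thesis
      using that automorphism_realizations[OF g] by (simp add: semi_isolates_iff)
  qed
  then show ?thesis
    using R by (simp add: strictly_semi_isolates_def)
qed

text \<open>The image of \<open>b\<close> under an automorphism sending \<open>a\<close> to
  \<open>a'\<close> is the witness. This allows one fixed first coordinate in the compactness
  argument and continues chains from any realization.\<close>

lemma ex_strictly_semi_isolated_from:
  assumes R: "a \<in> realizations M p" "b \<in> realizations M p" "a' \<in> realizations M p"
    and ab: "strictly_semi_isolates L M a b"
  shows "\<exists>b'\<in>realizations M p. strictly_semi_isolates L M a' b' \<and>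
    (\<forall>\<phi>\<in>formulas L 2. sat M \<phi> [a', b'] \<longleftrightarrow> sat M \<phi> [a, b])"
proof -
  obtain g where g: "automorphism L M g" "g a = a'"
    using homogeneous[OF R(1,3)] .
  show ?thesis
    using automorphism_strictly_semi_isolates[OF g(1) R(1,2)] automorphism_realizations[OF g(1)]
      automorphism_sat2[OF g(1)] R(2) ab g(2) by (intro bexI[of _ "g b"]) auto
qed

lemma tp_in_S_pp_iff:
  "tp L M [a, b] \<in> S_pp L M p \<longleftrightarrow> a \<in> realizations M p \<and> b \<in> realizations M p"
proof -
  have f: "wf_fml L 1 \<psi>" if "\<psi> \<in> p" for \<psi>
    using formulas_1[OF that] by (simp add: formulas_def)
  have "\<psi> \<in> tp L M [a, b] \<longleftrightarrow> sat M \<psi> [a]" if "\<psi> \<in> p" for \<psi>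
    using f[OF that] wf_fml_mono[of L 1 \<psi> 2] sat_cong[of L 1 \<psi> "[a, b]" "[a]" M]
    by (simp add: tp_def formulas_def numeral_2_eq_2)
  moreover have "rename Suc \<psi> \<in> tp L M [a, b] \<longleftrightarrow> sat M \<psi> [b]" if "\<psi> \<in> p" for \<psi>
    using f[OF that] wf_fml_rename[of L 1 \<psi> Suc 2] sat_rename[of L 1 \<psi> "[b]" "[a, b]" Suc M]
    by (simp add: tp_def formulas_def numeral_2_eq_2)
  moreover have "tp L M [a, b] \<in> type_space L M 2"
    using tp_in_type_space[of L M "[a, b]"] by (simp add: numeral_2_eq_2)
  ultimately show ?thesis
    by (auto simp: S_pp_def realizations_def)
qed

section \<open>Compactness: one formula covering all strict pairs\<close>

lemma tp_in_S_mapsto: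
  assumes "a \<in> realizations M p" "b \<in> realizations M p" "strictly_semi_isolates L M a b"
  shows "tp L M [a, b] \<in> S_mapsto L M p"
  using assms tp_in_S_pp_iff unfolding S_mapsto_def by blast

text \<open>Otherwise saturation yields a pair that satisfies no confining formula and whose type is
  a limit of types in \<open>S_mapsto\<close>. Closedness puts this type into
  \<open>S_mapsto\<close>, where semi-isolation demands a confining formula.\<close>

lemma uniform_confining:
  assumes closed: "closedin (subtopology (type_topology L M 2) (S_pp L M p)) (S_mapsto L M p)"
  obtains \<phi> where "\<phi> \<in> confining L M p"
    "\<And>a b. a \<in> realizations M p \<Longrightarrow> b \<in> realizations M p \<Longrightarrow> strictly_semi_isolates L M a b \<Longrightarrow>
      sat M \<phi> [a, b]"
proof -
  have "\<exists>\<phi>\<in>confining L M p. \<forall>a\<in>realizations M p. \<forall>b\<in>realizations M p.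
      strictly_semi_isolates L M a b \<longrightarrow> sat M \<phi> [a, b]"
  proof (rule ccontr)
    assume *: "\<not> ?thesis"
    \<comment> \<open>Equality is confining, so its failure to be uniform supplies a realization of
      \<open>p\<close>; by homogeneity any realization can serve as base point.\<close>
    then obtain a where a: "a \<in> realizations M p"
      using confining_Eq by blast
    define D where "D \<phi> = {b \<in> realizations M p. strictly_semi_isolates L M a b \<and> \<not> sat M \<phi> [a, b]}"
      for \<phi>
    have D: "D \<phi> \<noteq> {}" if \<phi>: "\<phi> \<in> confining L M p" for \<phi>
    proof -
      obtain a' b where b: "a' \<in> realizations M p" "b \<in> realizations M p"
        "strictly_semi_isolates L M a' b" "\<not> sat M \<phi> [a', b]"
        using * \<phi> by blast
      moreover have "\<phi> \<in> formulas L 2"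
        using \<phi> by (simp add: confining_def)
      ultimately show ?thesis
        using ex_strictly_semi_isolated_from[OF b(1,2) a b(3)] unfolding D_def by blast
    qed
    text \<open>The filter generated by the sets \<open>D \<phi>\<close> is proper; a realization of its definable
      members lies in the closure of \<open>S\<^sup>p\<^sub>\<mapsto>\<close> and avoids all \<open>\<phi>\<close>.\<close>
    define \<Gamma>0 where "\<Gamma>0 = {\<xi> \<in> formulas L 2. \<exists>\<phi>\<in>confining L M p. \<forall>b\<in>D \<phi>. sat M \<xi> [a, b]}"
    \<comment> \<open>In \<open>saturated\<close> the sought element stands at index 0, before the
      parameters, so the two variables are swapped; \<open>1 - i\<close> exchanges 0 and 1.\<close>
    define sw :: "('f, 'r) fml \<Rightarrow> ('f, 'r) fml" where "sw = rename (\<lambda>i. 1 - i)"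
    have sat_sw: "sat M (sw \<xi>) [c, a] \<longleftrightarrow> sat M \<xi> [a, c]" if "\<xi> \<in> formulas L 2" for \<xi> c
      by (simp add: sw_def sat_rename2[OF that])
    have common: "\<exists>\<phi>\<in>confining L M p. \<forall>\<xi>\<in>\<Delta>. \<forall>b\<in>D \<phi>. sat M \<xi> [a, b]"
      if "finite \<Delta>" "\<Delta> \<subseteq> \<Gamma>0" for \<Delta>
      using that
    proof (induction \<Delta>)
      case empty
      then show ?case
        using confining_Eq by blast
    next
      case (insert \<xi> \<Delta>)
      then obtain \<phi> \<psi> where \<phi>: "\<phi> \<in> confining L M p" "\<forall>\<xi>\<in>\<Delta>. \<forall>b\<in>D \<phi>. sat M \<xi> [a, b]"
        and \<psi>: "\<psi> \<in> confining L M p" "\<forall>b\<in>D \<psi>. sat M \<xi> [a, b]"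
        unfolding \<Gamma>0_def by blast
      \<comment> \<open>The counterexamples to a disjunction are counterexamples to both disjuncts,
        so finitely many members of \<open>\<Gamma>0\<close> hold on one common
        \<open>D \<phi>\<close>.\<close>
      have "D (Neg (And (Neg \<phi>) (Neg \<psi>))) \<subseteq> D \<phi> \<inter> D \<psi>"
        by (auto simp: D_def)
      then show ?case
        using \<phi> \<psi> confining_Or by blast
    qed
    have "\<exists>c. \<forall>(\<phi>, as)\<in>(\<lambda>\<xi>. (sw \<xi>, [a])) ` \<Gamma>0. sat M \<phi> (c # as)"
    proof -
      have "|{a}| <o \<kappa>"
        by (rule finite_card_less_monster[OF monster]) simp
      moreover have "(\<lambda>\<xi>. (sw \<xi>, [a])) ` \<Gamma>0
          \<subseteq> {(\<phi>, as). set as \<subseteq> {a} \<and> \<phi> \<in> formulas L (Suc (length as))}"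
        unfolding sw_def \<Gamma>0_def by (auto intro!: rename_formulas[of _ L 2])
      moreover have "\<exists>c. \<forall>(\<phi>, as)\<in>\<Delta>. sat M \<phi> (c # as)"
        if sub: "\<Delta> \<subseteq> (\<lambda>\<xi>. (sw \<xi>, [a])) ` \<Gamma>0" and fin: "finite \<Delta>" for \<Delta>
      proof -
        obtain \<Delta>' where \<Delta>': "finite \<Delta>'" "\<Delta>' \<subseteq> \<Gamma>0" "\<Delta> = (\<lambda>\<xi>. (sw \<xi>, [a])) ` \<Delta>'"
          using finite_subset_image[OF fin sub] by blast
        then obtain \<phi> where \<phi>: "\<phi> \<in> confining L M p" "\<forall>\<xi>\<in>\<Delta>'. \<forall>b\<in>D \<phi>. sat M \<xi> [a, b]"
          using common by blast
        then obtain b where "b \<in> D \<phi>"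
          using D by blast
        then have "\<forall>(\<phi>, as)\<in>\<Delta>. sat M \<phi> (b # as)"
          using \<phi>(2) \<Delta>'(2,3) sat_sw by (auto simp: \<Gamma>0_def)
        then show ?thesis
          by blast
      qed
      ultimately show ?thesis
        using monster unfolding monster_model_def saturated_def by blast
    qed
    then obtain b where b': "\<And>\<xi>. \<xi> \<in> \<Gamma>0 \<Longrightarrow> sat M (sw \<xi>) [b, a]"
      by auto
    have b: "sat M \<xi> [a, b]" if "\<xi> \<in> \<Gamma>0" for \<xi>
      using b'[OF that] that sat_sw[of \<xi> b] by (simp add: \<Gamma>0_def)
    have "sat M \<psi> [b]" if "\<psi> \<in> p" for \<psi>
    proof -
      have "\<psi> \<in> formulas L 1"
        using that by (rule formulas_1)
      then have sat: "sat M (rename Suc \<psi>) [a, c] \<longleftrightarrow> sat M \<psi> [c]" for c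
        by (intro sat_rename[of L 1]) (auto simp: formulas_def)
      have "rename Suc \<psi> \<in> formulas L 2"
        using \<open>\<psi> \<in> formulas L 1\<close> by (rule rename_formulas) simp
      \<comment> \<open>Every \<open>D \<phi>\<close> lies in \<open>p(M)\<close> by definition, so
        the one for equality suffices to put \<open>p(y)\<close> into the filter.\<close>
      moreover have "\<forall>c\<in>D (Eq (Var 0) (Var 1)). sat M (rename Suc \<psi>) [a, c]"
        using that by (auto simp: D_def sat realizations_def)
      ultimately have "rename Suc \<psi> \<in> \<Gamma>0"
        using confining_Eq unfolding \<Gamma>0_def by blast
      then show ?thesis
        using b sat by blast
    qed
    then have "b \<in> realizations M p"
      by (simp add: realizations_def)
    then have pp: "tp L M [a, b] \<in> S_pp L M p"
      using a tp_in_S_pp_iff by blast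
    have not_conf: "\<not> sat M \<phi> [a, b]" if "\<phi> \<in> confining L M p" for \<phi>
    proof -
      have "Neg \<phi> \<in> formulas L 2"
        using that by (simp add: confining_def formulas_def)
      moreover have "\<forall>c\<in>D \<phi>. sat M (Neg \<phi>) [a, c]"
        by (simp add: D_def)
      ultimately have "Neg \<phi> \<in> \<Gamma>0"
        using that unfolding \<Gamma>0_def by blast
      then show ?thesis
        using b by fastforce
    qed
    have "tp L M [a, b] \<in> S_mapsto L M p"
    proof (rule ccontr)
      assume "tp L M [a, b] \<notin> S_mapsto L M p"
      moreover have "topspace (subtopology (type_topology L M 2) (S_pp L M p)) = S_pp L M p"
        by (auto simp: topspace_type_topology S_pp_def)
      ultimately obtain U where U: "openin (type_topology L M 2) U"
        "S_pp L M p - S_mapsto L M p = U \<inter> S_pp L M p" "tp L M [a, b] \<in> U"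
        using closed pp unfolding closedin_def openin_subtopology by auto
      have "tp L M [a, b] \<in> type_space L M 2"
        using pp by (simp add: S_pp_def)
      then obtain \<xi> where \<xi>: "\<xi> \<in> formulas L 2" "\<xi> \<in> tp L M [a, b]"
        "{q \<in> type_space L M 2. \<xi> \<in> q} \<subseteq> U"
        using type_topology_nbhd[OF U(1,3)] by auto
      \<comment> \<open>The neighbourhood given by \<open>\<xi>\<close> misses
        \<open>S_mapsto\<close>, so \<open>\<xi>\<close> fails at every strict pair starting at
        \<open>a\<close>. Its negation is then in the filter and must hold at
        \<open>b\<close>.\<close>
      have "\<not> sat M \<xi> [a, c]" if "c \<in> D (Eq (Var 0) (Var 1))" for c
      proof
        assume "sat M \<xi> [a, c]"
        then have "\<xi> \<in> tp L M [a, c]"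
          using \<xi>(1) by (simp add: tp_def numeral_2_eq_2)
        moreover have "tp L M [a, c] \<in> S_pp L M p" "tp L M [a, c] \<in> S_mapsto L M p"
          using that a tp_in_S_pp_iff tp_in_S_mapsto by (auto simp: D_def)
        ultimately show False
          using U(2) \<xi>(3) unfolding S_pp_def by blast
      qed
      moreover have "Neg \<xi> \<in> formulas L 2"
        using \<xi>(1) by (simp add: formulas_def)
      ultimately have "Neg \<xi> \<in> \<Gamma>0"
        using confining_Eq unfolding \<Gamma>0_def by force
      then have "\<not> sat M \<xi> [a, b]"
        using b by fastforce
      with \<xi>(2) show False
        by (simp add: tp_def)
    qed
    \<comment> \<open>Membership in \<open>S_mapsto\<close> only provides some strict pair of the
      same type; that type transfers its confining formula to \<open>a\<close> and
      \<open>b\<close>.\<close>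
    then obtain a' b' where tp: "tp L M [a, b] = tp L M [a', b']" "tp L M [a', b'] \<in> S_pp L M p"
      and "strictly_semi_isolates L M a' b'"
      unfolding S_mapsto_def by blast
    then obtain \<phi> where \<phi>: "\<phi> \<in> confining L M p" "sat M \<phi> [a', b']"
      using tp_in_S_pp_iff semi_isolates_iff by (auto simp: strictly_semi_isolates_def)
    then have "\<phi> \<in> tp L M [a', b']"
      by (simp add: tp_def confining_def numeral_2_eq_2)
    then have "sat M \<phi> [a, b]"
      using tp(1) by (auto simp: tp_def)
    with not_conf \<phi>(1) show False
      by blast
  qed
  then show thesis
    using that by blast
qed

section \<open>The chain, the definable quasi-order and strict order\<close>

lemma strictly_semi_isolates_chain:
  assumes "asymmetric L M p"
  obtains a :: "nat \<Rightarrow> 'm" where "\<And>i. a i \<in> realizations M p"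
    "\<And>i. strictly_semi_isolates L M (a i) (a (Suc i))"
proof -
  obtain x y where xy: "x \<in> realizations M p" "y \<in> realizations M p" "strictly_semi_isolates L M x y"
    using assms by (auto simp: asymmetric_def sym_def SI_def strictly_semi_isolates_def)
  have "\<exists>a. \<forall>i. a i \<in> realizations M p \<and> strictly_semi_isolates L M (a i) (a (Suc i))"
  proof (rule dependent_nat_choice)
    show "\<exists>x. x \<in> realizations M p"
      using xy by blast
    show "\<exists>b. b \<in> realizations M p \<and> strictly_semi_isolates L M a b"
      if "a \<in> realizations M p" for a and n :: nat
      using ex_strictly_semi_isolated_from[OF xy(1,2) that xy(3)] by blast
  qed
  then show thesis
    using that by blast
qed

theorem partially_definable_and_strict_order:
  assumes "asymmetric L M p"
    and "closedin (subtopology (type_topology L M 2) (S_pp L M p)) (S_mapsto L M p)"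
  shows "semi_isolation_partially_definable L M p \<and> strict_order_property L M"
proof -
  let ?P = "realizations M p"
  obtain \<phi>0 where \<phi>0: "\<phi>0 \<in> confining L M p"
    "\<And>a b. a \<in> ?P \<Longrightarrow> b \<in> ?P \<Longrightarrow> strictly_semi_isolates L M a b \<Longrightarrow> sat M \<phi>0 [a, b]"
    using uniform_confining[OF assms(2)] by blast
  obtain a where a: "\<And>i. a i \<in> ?P" "\<And>i. strictly_semi_isolates L M (a i) (a (Suc i))"
    using strictly_semi_isolates_chain[OF assms(1)] by blast
  \<comment> \<open>Adding equality makes the formula reflexive on all of \<open>M\<close> and keeps
    it confining.\<close>
  define \<phi> where "\<phi> = Neg (And (Neg \<phi>0) (Neg (Eq (Var 0) (Var 1))))"
  have conf: "\<phi> \<in> confining L M p"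
    using confining_Or[OF \<phi>0(1) confining_Eq] by (simp add: \<phi>_def)
  then have \<phi>: "\<phi> \<in> formulas L 2"
    by (simp add: confining_def)
  have refl: "sat M \<phi> [x, x]" for x
    by (simp add: \<phi>_def)
  have strict: "sat M \<phi> [x, y]" if "x \<in> ?P" "y \<in> ?P" "strictly_semi_isolates L M x y" for x y
    using \<phi>0(2)[OF that] by (simp add: \<phi>_def)
  have in_P: "y \<in> ?P" if "sat M \<phi> [x, y]" "x \<in> ?P" for x y
    using conf that by (auto simp: confining_def)
  have si: "semi_isolates L M x y" if "sat M \<phi> [x, y]" "x \<in> ?P" for x y
    using semi_isolates_iff in_P[OF that] that conf by blast
  \<comment> \<open>Index 0 is the bound \<open>z\<close>, while 1 and 2 are \<open>x\<close> and
    \<open>y\<close>; the formula expresses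
    \<open>\<phi>(y,M) \<subseteq> \<phi>(x,M)\<close>.\<close>
  define \<theta> where
    "\<theta> = Neg (Ex (And (rename (case_nat 2 (\<lambda>_. 0)) \<phi>) (Neg (rename (case_nat 1 (\<lambda>_. 0)) \<phi>))))"
  have sat_\<theta>: "sat M \<theta> [x, y] \<longleftrightarrow> (\<forall>z. sat M \<phi> [y, z] \<longrightarrow> sat M \<phi> [x, z])" for x y
    by (simp add: \<theta>_def sat_rename2[OF \<phi>])
  have "rename (case_nat 2 (\<lambda>_. 0)) \<phi> \<in> formulas L 3" "rename (case_nat 1 (\<lambda>_. 0)) \<phi> \<in> formulas L 3"
    using \<phi> by (auto intro!: rename_formulas split: nat.split)
  then have \<theta>: "\<theta> \<in> formulas L 2"
    by (simp add: \<theta>_def formulas_def numeral_3_eq_3 numeral_2_eq_2)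
  \<comment> \<open>Reflexivity allows \<open>z = y\<close> in the inclusion.\<close>
  have \<theta>_\<phi>: "sat M \<phi> [x, y]" if "sat M \<theta> [x, y]" for x y
    using that refl sat_\<theta> by blast
  have \<theta>_conf: "\<theta> \<in> confining L M p"
    using \<theta> \<theta>_\<phi> in_P by (auto simp: confining_def)
  have strict_\<theta>: "sat M \<theta> [x, y]" if xy: "x \<in> ?P" "y \<in> ?P" "strictly_semi_isolates L M x y" for x y
    unfolding sat_\<theta>
  proof (intro allI impI)
    fix z assume "sat M \<phi> [y, z]"
    then have "z \<in> ?P" "semi_isolates L M y z"
      using in_P si xy(2) by blast+
    then show "sat M \<phi> [x, z]"
      using strict strictly_semi_isolates_trans xy by blast
  qed
  let ?Q = "{(x, y). sat M \<theta> [x, y]} \<inter> ?P \<times> ?P"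
  have "preorder_on UNIV {(x, y). sat M \<theta> [x, y]}"
    by (auto simp: preorder_on_def refl_on_def trans_def sat_\<theta>)
  moreover have "p_order L M p ?Q"
    unfolding p_order_def
  proof (intro conjI)
    show "preorder_on ?P ?Q"
      by (auto simp: preorder_on_def refl_on_def trans_def sat_\<theta>)
    \<comment> \<open>The reverse relation would give \<open>\<phi>\<close> from
      \<open>a (Suc i)\<close> to \<open>a i\<close>, hence semi-isolation against the strict
      step.\<close>
    have "(a i, a (Suc i)) \<in> ?Q \<and> (a (Suc i), a i) \<notin> ?Q" for i
      using a strict_\<theta> \<theta>_\<phi> si unfolding strictly_semi_isolates_def by blast
    then show "\<exists>a. \<forall>i. (a i, a (Suc i)) \<in> ?Q \<and> (a (Suc i), a i) \<notin> ?Q"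
      by blast
    show "\<exists>\<phi>\<in>formulas L 2. ?Q = {(a, b). sat M \<phi> [a, b]} \<inter> ?P \<times> ?P"
      using \<theta> by blast
    show "?Q \<subseteq> SI L M p"
      using \<theta>_\<phi> si by (auto simp: SI_def)
  qed
  moreover have "strictly_semi_isolates_by L M \<theta> x z"
    if "x \<in> ?P" "z \<in> ?P" and xy: "strictly_semi_isolates_by L M \<theta> x y" and "semi_isolates L M y z"
    for x y z
  proof -
    have "sat M \<theta> [x, y]"
      using xy by (simp add: strictly_semi_isolates_by_def semi_isolates_by_def)
    \<comment> \<open>The middle element is not assumed to realize \<open>p\<close>; since
      \<open>\<theta>\<close> implies the confining \<open>\<phi>\<close>, it does, and transitivity
      on \<open>p(M)\<close> applies.\<close>
    then have "y \<in> ?P"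
      using \<theta>_\<phi> in_P that(1) by blast
    moreover have "strictly_semi_isolates L M x y"
      using xy \<theta> by (auto simp: strictly_semi_isolates_by_def strictly_semi_isolates_def semi_isolates_def)
    ultimately have "strictly_semi_isolates L M x z"
      using strictly_semi_isolates_trans that by blast
    then show ?thesis
      using strict_\<theta> that(1,2) \<theta>_conf semi_isolates_by_confining
      by (simp add: strictly_semi_isolates_by_def strictly_semi_isolates_def)
  qed
  ultimately have "semi_isolation_partially_definable L M p"
    using \<theta> unfolding semi_isolation_partially_definable_def by blast
  moreover have "strict_order_property L M"
  proof -
    \<comment> \<open>The sets \<open>\<phi>(a i, M)\<close> decrease, so their complements increase.\<close>
    define \<psi> where "\<psi> = Neg (rename (\<lambda>i. 1 - i) \<phi>)"
    have sat_\<psi>: "sat M \<psi> [x, y] \<longleftrightarrow> \<not> sat M \<phi> [y, x]" for x y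
      by (simp add: \<psi>_def sat_rename2[OF \<phi>])
    have "rename (\<lambda>i. 1 - i) \<phi> \<in> formulas L 2"
      using \<phi> by (rule rename_formulas) simp
    then have "\<psi> \<in> formulas L (1 + 1)"
      by (simp add: \<psi>_def formulas_def numeral_2_eq_2)
    moreover have "{xs. length xs = 1 \<and> sat M \<psi> (xs @ [a i])}
        \<subset> {xs. length xs = 1 \<and> sat M \<psi> (xs @ [a (Suc i)])}" for i
    proof (rule psubsetI)
      have "sat M \<theta> [a i, a (Suc i)]"
        using strict_\<theta> a by blast
      then show "{xs. length xs = 1 \<and> sat M \<psi> (xs @ [a i])}
          \<subseteq> {xs. length xs = 1 \<and> sat M \<psi> (xs @ [a (Suc i)])}"
        by (auto simp: length_Suc_conv sat_\<psi> sat_\<theta>)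
      \<comment> \<open>The element \<open>a i\<close> itself witnesses properness: reflexivity
        keeps it in \<open>\<phi>(a i, M)\<close>, and strictness excludes it from the next
        set.\<close>
      have "\<not> sat M \<phi> [a (Suc i), a i]"
        using si a unfolding strictly_semi_isolates_def by blast
      then have "[a i] \<in> {xs. length xs = 1 \<and> sat M \<psi> (xs @ [a (Suc i)])}"
        "[a i] \<notin> {xs. length xs = 1 \<and> sat M \<psi> (xs @ [a i])}"
        using refl by (auto simp: sat_\<psi>)
      then show "{xs. length xs = 1 \<and> sat M \<psi> (xs @ [a i])}
          \<noteq> {xs. length xs = 1 \<and> sat M \<psi> (xs @ [a (Suc i)])}"
        by metis
    qed
    ultimately show ?thesis
      unfolding strict_order_property_def
      by (intro exI[of _ 1] bexI[of _ \<psi>] exI[of _ "\<lambda>i. [a i]"]) auto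
  qed
  ultimately show ?thesis
    by blast
qed

end

theorem theorem2p9:
  fixes L :: "('f, 'r) language"
    and T :: "('f, 'r) fml set"
    and \<kappa> :: "'k rel"
    and M :: "('f, 'r, 'm) struct"
    and p :: "('f, 'r) fml set"
  assumes "countable_language L"
    and "complete_theory L T"
    and "monster_model L T \<kappa> M"
    and "p \<in> type_space L M 1"
    and "asymmetric L M p"
    and "closedin (subtopology (type_topology L M 2) (S_pp L M p)) (S_mapsto L M p)"
  shows "semi_isolation_partially_definable L M p \<and> strict_order_property L M"
proof -
  interpret monster_type L T \<kappa> M p
    using assms by unfold_locales
  show ?thesis
    using assms by (intro partially_definable_and_strict_order)
qed

end
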